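(* Let $\mathbf{r}$ be a finite table, $X$ a set of attributes and $A, B$ two attributes. If the functional dependency $XA \to B$ holds in $\mathbf{r}$, then the conditional implicit-to-implicit candidate $X\colon A^* \sim B^*$ (a conditional I/I OD candidate) is valid over $\mathbf{r}$. Furthermore, there is a unique partial order that can be derived for $A^*$ and for $B^*$: the empty order. That is, in every partition group of $\mathbf r$ by $X$ and for every witness, the strongest derivable orders $A^*$ and $B^*$ are both the empty relation.
   Context: A table $\mathbf{r}$ is a finite collection of tuples. The partition groups of $\mathbf r$ by an attribute set $X$ are the maximal sets of tuples agreeing on all attributes of $X$ (the whole table if $X=\emptyset$). The functional dependency $XA\to B$ holds if any two tuples that agree on all attributes of $X$ and on $A$ also agree on $B$. A strong total order is a transitive, irreflexive relation in which any two distinct elements are comparable. For a strong total order $T$ on a set of tuples and an attribute $C$, list the $C$-values of the tuples in the order $T$ and collapse adjacent equal values. If no value then occurs twice, $T$ is said to project to a strong total order on $C$'s values, called the order derived from $T$ on $C$. A witness for $A^*\sim B^*$ over a set $E$ of tuples is a strong total order on $E$ that projects to a strong total order both on the $A$-values and on the $B$-values of $E$. (No order on $A$ or $B$ is given.) The conditional candidate $X\colon A^*\sim B^*$ is valid over $\mathbf r$ if every partition group of $\mathbf r$ by $X$ has a witness; partition groups are treated independently of each other. Given a witness over a partition group, a valid transposition moves a contiguous sub-sequence of tuples to another location in the order, subject to the condition that the resulting order is again a witness. The witness class of a witness is the set of all witnesses over the group reachable from it by finitely many valid transpositions. Given a witness $T$, the strongest derivable order $A^*$ (respectively $B^*$)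 is the intersection of the orders derived on $A$ (respectively $B$) from all members of the witness class of $T$. *)

theory Defs
  imports Main
begin

text \<open>
  A table is a finite set of tuples together with a map \<open>val\<close> giving the value \<open>val t C\<close> of the
  tuple \<open>t\<close> in the attribute \<open>C\<close>. Tuples are abstract, so a table may contain two distinct tuples
  with the same values; taking \<open>val = id\<close> gives tuples that are functions on the attributes.
\<close>

definition agree :: "('t \<Rightarrow> 'attr \<Rightarrow> 'v) \<Rightarrow> 'attr set \<Rightarrow> 't \<Rightarrow> 't \<Rightarrow> bool" where
  "agree val X s t \<longleftrightarrow> (\<forall>C\<in>X. val s C = val t C)"

definition agreeing_subset :: "('t \<Rightarrow> 'attr \<Rightarrow> 'v) \<Rightarrow> 't set \<Rightarrow> 'attr set \<Rightarrow> 't set \<Rightarrow> bool" where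
  "agreeing_subset val r X G \<longleftrightarrow> G \<subseteq> r \<and> (\<forall>s\<in>G. \<forall>t\<in>G. agree val X s t)"

definition partition_groups :: "('t \<Rightarrow> 'attr \<Rightarrow> 'v) \<Rightarrow> 't set \<Rightarrow> 'attr set \<Rightarrow> 't set set" where
  "partition_groups val r X =
     {G. agreeing_subset val r X G \<and> (\<forall>H. agreeing_subset val r X H \<and> G \<subseteq> H \<longrightarrow> H = G)}"

definition functional_dependency ::
  "('t \<Rightarrow> 'attr \<Rightarrow> 'v) \<Rightarrow> 't set \<Rightarrow> 'attr set \<Rightarrow> 'attr \<Rightarrow> bool" where
  "functional_dependency val r Y B \<longleftrightarrow>
     (\<forall>s\<in>r. \<forall>t\<in>r. agree val Y s t \<longrightarrow> val s B = val t B)"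

definition strong_total_order :: "'t set \<Rightarrow> 't rel \<Rightarrow> bool" where
  "strong_total_order E T \<longleftrightarrow> T \<subseteq> E \<times> E \<and> strict_linear_order_on E T"

text \<open>
  The elements of \<open>E\<close> listed in the order \<open>T\<close>; meaningful for finite \<open>E\<close>
  and a strong total order \<open>T\<close> on \<open>E\<close> (see \<open>order_list\<close> below).
\<close>

definition order_list :: "'t set \<Rightarrow> 't rel \<Rightarrow> 't list" where
  "order_list E T = (THE xs. set xs = E \<and> sorted_wrt (\<lambda>x y. (x, y) \<in> T) xs)"

lemma order_list_ex1:
  assumes "finite E" and "strong_total_order E T"
  shows "\<exists>!xs. set xs = E \<and> sorted_wrt (\<lambda>x y. (x, y) \<in> T) xs"
proof (rule ex_ex1I)
  have tr: "trans T" and ir: "irrefl T" and tot: "total_on E T"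
    using assms(2) by (auto simp: strong_total_order_def strict_linear_order_on_def)
  have "\<exists>xs. set xs = F \<and> sorted_wrt (\<lambda>x y. (x, y) \<in> T) xs" if "finite F" "F \<subseteq> E" for F
    using that
  proof (induction F rule: finite_induct)
    case empty
    show ?case by simp
  next
    case (insert a F)
    then obtain xs where xs: "set xs = F" "sorted_wrt (\<lambda>x y. (x, y) \<in> T) xs" by auto
    let ?ys = "filter (\<lambda>y. (y, a) \<in> T) xs @ a # filter (\<lambda>y. (a, y) \<in> T) xs"
    have "set ?ys = insert a F"
      using xs(1) insert.hyps insert.prems tot unfolding total_on_def by auto
    moreover have "sorted_wrt (\<lambda>x y. (x, y) \<in> T) ?ys"
      using xs(2) tr by (auto simp: sorted_wrt_append sorted_wrt_filter dest: transD)
    ultimately show ?case by blast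
  qed
  then show "\<exists>xs. set xs = E \<and> sorted_wrt (\<lambda>x y. (x, y) \<in> T) xs"
    using assms(1) by blast
  have "xs = ys" if "sorted_wrt (\<lambda>x y. (x, y) \<in> T) xs" "sorted_wrt (\<lambda>x y. (x, y) \<in> T) ys"
    "set xs = set ys" for xs ys
    using that
  proof (induction xs arbitrary: ys)
    case Nil
    then show ?case by simp
  next
    case (Cons x xs)
    then obtain y zs where ys: "ys = y # zs" by (cases ys) auto
    have xy: "x = y"
    proof (rule ccontr)
      assume "x \<noteq> y"
      then have "(x, y) \<in> T" "(y, x) \<in> T" using Cons.prems ys by auto
      then show False using tr ir by (meson irreflD transD)
    qed
    have "x \<notin> set xs" "y \<notin> set zs" using Cons.prems ys ir by (auto dest: irreflD)
    then have "set xs = set zs" using Cons.prems(3) ys xy by auto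
    then show ?case using Cons ys xy by auto
  qed
  then show "xs = ys" if "set xs = E \<and> sorted_wrt (\<lambda>x y. (x, y) \<in> T) xs"
    "set ys = E \<and> sorted_wrt (\<lambda>x y. (x, y) \<in> T) ys" for xs ys
    using that by blast
qed

lemma order_list:
  assumes "finite E" and "strong_total_order E T"
  shows "set (order_list E T) = E"
    and "sorted_wrt (\<lambda>x y. (x, y) \<in> T) (order_list E T)"
  using theI'[OF order_list_ex1[OF assms]] unfolding order_list_def by auto

definition collapsed_values ::
  "('t \<Rightarrow> 'attr \<Rightarrow> 'v) \<Rightarrow> 't set \<Rightarrow> 't rel \<Rightarrow> 'attr \<Rightarrow> 'v list" where
  "collapsed_values val E T C = remdups_adj (map (\<lambda>t. val t C) (order_list E T))"

definition projects :: "('t \<Rightarrow> 'attr \<Rightarrow> 'v) \<Rightarrow> 't set \<Rightarrow> 't rel \<Rightarrow> 'attr \<Rightarrow> bool" where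
  "projects val E T C \<longleftrightarrow> distinct (collapsed_values val E T C)"

definition derived_order :: "('t \<Rightarrow> 'attr \<Rightarrow> 'v) \<Rightarrow> 't set \<Rightarrow> 't rel \<Rightarrow> 'attr \<Rightarrow> 'v rel" where
  "derived_order val E T C =
     (let vs = collapsed_values val E T C in {(vs ! i, vs ! j) | i j. i < j \<and> j < length vs})"

definition witness :: "('t \<Rightarrow> 'attr \<Rightarrow> 'v) \<Rightarrow> 't set \<Rightarrow> 'attr \<Rightarrow> 'attr \<Rightarrow> 't rel \<Rightarrow> bool" where
  "witness val E A B T \<longleftrightarrow>
     strong_total_order E T \<and> projects val E T A \<and> projects val E T B"

definition valid_candidate ::
  "('t \<Rightarrow> 'attr \<Rightarrow> 'v) \<Rightarrow> 't set \<Rightarrow> 'attr set \<Rightarrow> 'attr \<Rightarrow> 'attr \<Rightarrow> bool" where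
  "valid_candidate val r X A B \<longleftrightarrow>
     (\<forall>G\<in>partition_groups val r X. \<exists>T. witness val G A B T)"

text \<open>
  Moving a contiguous sub-sequence to another place, forwards or backwards, is the same as
  exchanging two adjacent contiguous sub-sequences \<open>vs\<close> and \<open>ws\<close>.
\<close>

definition valid_transposition ::
  "('t \<Rightarrow> 'attr \<Rightarrow> 'v) \<Rightarrow> 't set \<Rightarrow> 'attr \<Rightarrow> 'attr \<Rightarrow> 't rel \<Rightarrow> 't rel \<Rightarrow> bool" where
  "valid_transposition val E A B T T' \<longleftrightarrow>
     witness val E A B T \<and> witness val E A B T' \<and>
     (\<exists>us vs ws zs. vs \<noteq> [] \<and> ws \<noteq> [] \<and>
        order_list E T = us @ vs @ ws @ zs \<and> order_list E T' = us @ ws @ vs @ zs)"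

definition witness_class ::
  "('t \<Rightarrow> 'attr \<Rightarrow> 'v) \<Rightarrow> 't set \<Rightarrow> 'attr \<Rightarrow> 'attr \<Rightarrow> 't rel \<Rightarrow> 't rel set" where
  "witness_class val E A B T = {T'. (valid_transposition val E A B)\<^sup>*\<^sup>* T T'}"

text \<open>
  The strongest order on the attribute \<open>C\<close> derivable from the witness \<open>T\<close> for \<open>A\<close> and \<open>B\<close>;
  it is used with \<open>C = A\<close> and \<open>C = B\<close>.
\<close>

definition strongest_derivable_order ::
  "('t \<Rightarrow> 'attr \<Rightarrow> 'v) \<Rightarrow> 't set \<Rightarrow> 'attr \<Rightarrow> 'attr \<Rightarrow> 't rel \<Rightarrow> 'attr \<Rightarrow> 'v rel" where
  "strongest_derivable_order val E A B T C =
     (\<Inter>T'\<in>witness_class val E A B T. derived_order val E T' C)"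

end

(*
  In a partition group G, tuples that agree on A agree on B, so a list of G with contiguous
  A-blocks inside contiguous B-blocks is a witness. Given a witness and tuples s before t with
  different A-values, one transposition puts t before s: if their B-values differ, rotate the
  whole list at the beginning of a B-block separating s from t; otherwise rotate the common
  B-block at the beginning of an A-block separating them. Hence no pair of values is ordered
  in the same way by all members of a witness class.
*)
theory Submission
  imports Defs
begin

section \<open>Positions and runs of equal values in a list\<close>

text \<open>Stated by a cut of the list, a form that passes directly through appending and mapping.
  In a list with repetitions two elements may precede each other; \<open>precedes_asym\<close>
  therefore asks for distinctness.\<close>

definition precedes :: "'a list \<Rightarrow> 'a \<Rightarrow> 'a \<Rightarrow> bool" where
  "precedes xs a b \<longleftrightarrow> (\<exists>ps qs. xs = ps @ qs \<and> a \<in> set ps \<and> b \<in> set qs)"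

text \<open>The list form of \<open>projects\<close>, which lets the combinatorics be done on lists,
  apart from the orders.\<close>

definition contiguous :: "('a \<Rightarrow> 'b) \<Rightarrow> 'a list \<Rightarrow> bool" where
  "contiguous f xs \<longleftrightarrow> distinct (remdups_adj (map f xs))"

lemma precedes_iff_nth:
  "precedes xs a b \<longleftrightarrow> (\<exists>i j. i < j \<and> j < length xs \<and> a = xs ! i \<and> b = xs ! j)"
proof
  assume "precedes xs a b"
  then obtain ps qs i j where "xs = ps @ qs" "i < length ps" "a = ps ! i" "j < length qs" "b = qs ! j"
    unfolding precedes_def by (metis in_set_conv_nth)
  then have "i < length ps + j \<and> length ps + j < length xs \<and> a = xs ! i \<and> b = xs ! (length ps + j)"
    by (simp add: nth_append)
  then show "\<exists>i j. i < j \<and> j < length xs \<and> a = xs ! i \<and> b = xs ! j" by blast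
next
  assume "\<exists>i j. i < j \<and> j < length xs \<and> a = xs ! i \<and> b = xs ! j"
  then obtain i j where ij: "i < j" "j < length xs" "a = xs ! i" "b = xs ! j" by blast
  have "a \<in> set (take j xs)" using ij by (auto simp: in_set_conv_nth intro!: exI[of _ i])
  moreover have "b \<in> set (drop j xs)" using ij by (simp add: Cons_nth_drop_Suc[symmetric])
  ultimately show "precedes xs a b"
    unfolding precedes_def by (metis append_take_drop_id)
qed

lemma precedes_asym: "distinct xs \<Longrightarrow> precedes xs a b \<Longrightarrow> \<not> precedes xs b a"
  unfolding precedes_iff_nth by (metis nth_eq_iff_index_eq order_less_trans order_less_asym)

lemma precedes_total:
  assumes "a \<in> set xs" "b \<in> set xs" "a \<noteq> b"
  shows "precedes xs a b \<or> precedes xs b a"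
  using assms unfolding precedes_iff_nth in_set_conv_nth by (metis nat_neq_iff)

lemma precedes_append: "precedes ys a b \<Longrightarrow> precedes (xs @ ys @ zs) a b"
  unfolding precedes_def by (metis Un_iff append.assoc set_append)

lemma precedes_map: "precedes xs a b \<Longrightarrow> precedes (map f xs) (f a) (f b)"
  unfolding precedes_def by (metis image_eqI list.set_map map_append)

text \<open>Cut the list just after an occurrence of \<open>b\<close> that follows \<open>a\<close>.
  The collapsed prefix still contains \<open>a\<close> and ends with \<open>b\<close>, so
  \<open>a\<close> lies strictly before that last entry.\<close>

lemma precedes_remdups_adj:
  assumes "precedes xs a b" and "a \<noteq> b"
  shows "precedes (remdups_adj xs) a b"
proof -
  obtain ps qs where xs: "xs = ps @ qs" "a \<in> set ps" "b \<in> set qs"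
    using assms(1) unfolding precedes_def by blast
  then obtain us vs where qs: "qs = us @ b # vs" by (meson split_list)
  let ?l = "remdups_adj ((ps @ us) @ [b])"
  \<comment> \<open>\<open>tl\<close> drops the copy of \<open>b\<close> that already closes
    \<open>?l\<close>.\<close>
  have eq: "remdups_adj xs = ?l @ tl (remdups_adj (b # vs))"
    unfolding xs qs using remdups_adj_append[of "ps @ us" b vs] by simp
  have "?l \<noteq> []" "last ?l = b" "a \<in> set ?l" using xs by auto
  then have l: "?l = butlast ?l @ [b]" by (metis append_butlast_last_id)
  with \<open>a \<in> set ?l\<close> \<open>a \<noteq> b\<close> have "a \<in> set (butlast ?l)"
    by (metis Un_iff empty_iff insert_iff list.set set_append)
  then have "precedes ?l a b" unfolding precedes_def using l by (metis list.set_intros(1))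
  then show ?thesis unfolding eq using precedes_append[of ?l a b "[]"] by simp
qed

section \<open>Cutting a list at boundaries between runs\<close>

text \<open>Entries of the collapsed list correspond to maximal runs, so a cut between entries lifts
  to a cut between runs. This carries cuts of the value list back to the list of tuples.\<close>

lemma remdups_adj_eq_append:
  "remdups_adj xs = ps @ qs \<Longrightarrow> \<exists>us vs. xs = us @ vs \<and> remdups_adj us = ps \<and> remdups_adj vs = qs"
proof (induction xs arbitrary: ps rule: remdups_adj.induct)
  case 1
  then show ?case by simp
next
  case (2 x)
  then consider "ps = []" "qs = [x]" | "ps = [x]" "qs = []"
    by (auto simp: Cons_eq_append_conv)
  then show ?case
  proof cases
    case 1
    then show ?thesis by (intro exI[of _ "[]"] exI[of _ "[x]"]) simp
  next
    case 2
    then show ?thesis by (intro exI[of _ "[x]"] exI[of _ "[]"]) simp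
  qed
next
  case (3 x y xs)
  show ?case
  proof (cases "ps = []")
    case True
    then show ?thesis using 3(3) by (intro exI[of _ "[]"] exI[of _ "x # y # xs"]) simp
  next
    case False
    show ?thesis
    proof (cases "x = y")
      case True
      then obtain us vs where uv: "y # xs = us @ vs" "remdups_adj us = ps" "remdups_adj vs = qs"
        using 3 by auto
      \<comment> \<open>Here \<open>us\<close> starts with \<open>y = x\<close>, so putting
        \<open>x\<close> in front of it only lengthens its first run.\<close>
      then obtain us' where "us = y # us'" using False by (cases us) auto
      then show ?thesis using uv True by (intro exI[of _ "x # us"] exI[of _ vs]) auto
    next
      case neq: False
      then obtain ps' where ps: "ps = x # ps'" "remdups_adj (y # xs) = ps' @ qs"
        using False 3(3) by (auto simp: Cons_eq_append_conv)
      then obtain us vs where uv: "y # xs = us @ vs" "remdups_adj us = ps'" "remdups_adj vs = qs"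
        using 3(2) neq by blast
      \<comment> \<open>Either \<open>us\<close> is empty or it starts with \<open>y\<close>, which
        differs from \<open>x\<close>; in both cases \<open>x\<close> opens a run of its
        own.\<close>
      then have "remdups_adj (x # us) = ps" using neq ps by (cases us) auto
      then show ?thesis using uv by (intro exI[of _ "x # us"] exI[of _ vs]) auto
    qed
  qed
qed

lemma remdups_adj_map_eq_append:
  assumes "remdups_adj (map f xs) = ps @ qs"
  obtains us vs where "xs = us @ vs" "remdups_adj (map f us) = ps" "remdups_adj (map f vs) = qs"
  using remdups_adj_eq_append[OF assms] by (auto simp: map_eq_append_conv)

lemma image_eq_set_remdups_adj_map: "remdups_adj (map f xs) = ps \<Longrightarrow> f ` set xs = set ps"
  by (metis list.set_map remdups_adj_set)

text \<open>Without a common value no run crosses the junction, so collapsing commutes with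
  appending, and no value can recur on the other side.\<close>

lemma contiguous_append:
  assumes "f ` set xs \<inter> f ` set ys = {}"
  shows "contiguous f (xs @ ys) \<longleftrightarrow> contiguous f xs \<and> contiguous f ys"
proof -
  have "map f xs = [] \<or> map f ys = [] \<or> last (map f xs) \<noteq> hd (map f ys)"
    using assms by (metis disjoint_iff hd_in_set last_in_set list.set_map)
  then have "remdups_adj (map f xs @ map f ys) = remdups_adj (map f xs) @ remdups_adj (map f ys)"
    by (rule remdups_adj_append')
  then show ?thesis using assms by (simp add: contiguous_def)
qed

lemma contiguous_const:
  assumes "\<And>x. x \<in> set xs \<Longrightarrow> f x = c"
  shows "contiguous f xs"
proof -
  have "map f xs = replicate (length xs) c" using assms by (simp add: list_eq_iff_nth_eq)
  then show ?thesis by (simp add: contiguous_def remdups_adj_replicate)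
qed

text \<open>Lift a cut of the collapsed value list between \<open>f s\<close> and
  \<open>f t\<close>. Its entries are distinct, so each value lies wholly on one side, and swapping
  the sides breaks no block.\<close>

lemma contiguous_split:
  assumes "contiguous f xs" and "precedes xs s t" and "f s \<noteq> f t"
  obtains vs ws where "xs = vs @ ws" "s \<in> set vs" "t \<in> set ws" "f ` set vs \<inter> f ` set ws = {}"
proof -
  obtain ps qs where pq: "remdups_adj (map f xs) = ps @ qs" "f s \<in> set ps" "f t \<in> set qs"
    using precedes_remdups_adj[OF precedes_map[OF assms(2)] assms(3)] unfolding precedes_def by blast
  obtain vs ws where vw: "xs = vs @ ws" "remdups_adj (map f vs) = ps" "remdups_adj (map f ws) = qs"
    using pq(1) by (rule remdups_adj_map_eq_append)
  note im = vw(2,3)[THEN image_eq_set_remdups_adj_map]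
  have dis: "f ` set vs \<inter> f ` set ws = {}"
    using assms(1) pq(1) im by (auto simp: contiguous_def)
  have "s \<in> set xs" "t \<in> set xs" using assms(2) unfolding precedes_def by auto
  moreover have "s \<notin> set ws" "t \<notin> set vs" using pq im dis by (metis disjoint_iff imageI)+
  ultimately show thesis using that[OF vw(1) _ _ dis] vw(1) by auto
qed

text \<open>Cut the collapsed list before and after its only entry \<open>f s\<close>; the middle
  part lifts to the whole block of that value.\<close>

lemma contiguous_block:
  assumes "contiguous f xs" and "s \<in> set xs"
  obtains us ms zs where "xs = us @ ms @ zs" "f ` set ms = {f s}"
    "f s \<notin> f ` set us" "f s \<notin> f ` set zs" "f ` set us \<inter> f ` set zs = {}"
proof -
  have "f s \<in> set (remdups_adj (map f xs))" using assms(2) by simp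
  then obtain ps qs where pq: "remdups_adj (map f xs) = ps @ [f s] @ qs"
    by (metis append_Cons append_Nil split_list)
  obtain us vs where uv: "xs = us @ vs" "remdups_adj (map f us) = ps"
    "remdups_adj (map f vs) = [f s] @ qs"
    using pq by (rule remdups_adj_map_eq_append)
  obtain ms zs where mz: "vs = ms @ zs" "remdups_adj (map f ms) = [f s]" "remdups_adj (map f zs) = qs"
    using uv(3) by (rule remdups_adj_map_eq_append)
  note im = uv(2)[THEN image_eq_set_remdups_adj_map] mz(2,3)[THEN image_eq_set_remdups_adj_map]
  show thesis
    using assms(1) pq im uv(1) mz(1) by (intro that[of us ms zs]) (auto simp: contiguous_def)
qed

section \<open>The exchange that reverses a pair\<close>

text \<open>The roles are \<open>f\<close> for \<open>A\<close> and \<open>g\<close> for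
  \<open>B\<close>. The swapped segments never share an \<open>f\<close>-value; for \<open>g\<close>
  they either share no value or lie in a single block, so both contiguities survive.\<close>

lemma exchange_reversing_pair:
  assumes "distinct xs" and cf: "contiguous f xs" and cg: "contiguous g xs"
    and fg: "\<And>x y. x \<in> set xs \<Longrightarrow> y \<in> set xs \<Longrightarrow> f x = f y \<Longrightarrow> g x = g y"
    and st: "precedes xs s t" "f s \<noteq> f t"
  obtains us vs ws zs where "xs = us @ vs @ ws @ zs" "s \<in> set vs" "t \<in> set ws"
    "contiguous f (us @ ws @ vs @ zs)" "contiguous g (us @ ws @ vs @ zs)"
proof (cases "g s = g t")
  case False
  obtain vs ws where vw: "xs = vs @ ws" "s \<in> set vs" "t \<in> set ws" "g ` set vs \<inter> g ` set ws = {}"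
    using contiguous_split[OF cg st(1) False] .
  \<comment> \<open>A common \<open>f\<close>-value would force a common \<open>g\<close>-value
    across the cut.\<close>
  have "f x \<noteq> f y" if "x \<in> set vs" "y \<in> set ws" for x y
    using fg[of x y] vw that by auto
  then have "f ` set vs \<inter> f ` set ws = {}" by auto
  then show thesis
    using vw cf cg by (intro that[of "[]" vs ws "[]"]) (auto simp: contiguous_append Int_commute)
next
  case True
  have inxs: "s \<in> set xs" "t \<in> set xs" using st(1) unfolding precedes_def by auto
  obtain us ms zs where b: "xs = us @ ms @ zs" "g ` set ms = {g s}"
    "g s \<notin> g ` set us" "g s \<notin> g ` set zs" "g ` set us \<inter> g ` set zs = {}"
    using contiguous_block[OF cg inxs(1)] .
  have ms: "s \<in> set ms" "t \<in> set ms"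
    using inxs b True by (auto simp: image_iff)
  have gdis: "g ` set us \<inter> g ` set (ms @ zs) = {}" "g ` set ms \<inter> g ` set zs = {}"
    unfolding set_append image_Un using b(2-5) by simp_all
  have "f x \<noteq> f y" if "x \<in> set us" "y \<in> set (ms @ zs)" for x y
    using fg[of x y] gdis(1) b(1) that by auto
  moreover have "f x \<noteq> f y" if "x \<in> set ms" "y \<in> set zs" for x y
    using fg[of x y] gdis(2) b(1) that by auto
  ultimately have fdis: "f ` set us \<inter> f ` set (ms @ zs) = {}" "f ` set ms \<inter> f ` set zs = {}"
    by auto
  have c: "contiguous f us" "contiguous f ms" "contiguous f zs" "contiguous g us" "contiguous g zs"
    using cf cg fdis gdis unfolding b(1) by (simp_all add: contiguous_append)
  \<comment> \<open>An inversion inside the segment \<open>ms\<close> would be one in the distinct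
    list \<open>xs\<close>.\<close>
  have "\<not> precedes ms t s"
    using precedes_append[of ms t s us zs] precedes_asym[OF assms(1) st(1)] b(1) by auto
  then have "precedes ms s t" using precedes_total[OF ms] st(2) by auto
  then obtain vs ws where vw: "ms = vs @ ws" "s \<in> set vs" "t \<in> set ws" "f ` set vs \<inter> f ` set ws = {}"
    using contiguous_split[OF c(2)] st(2) by metis
  have set_eq: "set (ws @ vs) = set ms" using vw(1) by auto
  have "contiguous f (ws @ vs)"
    using c(2) vw by (auto simp: contiguous_append Int_commute)
  \<comment> \<open>\<open>g\<close> is constant on \<open>ms\<close>, so any rearrangement of
    \<open>ms\<close> is contiguous for it.\<close>
  moreover have "contiguous g (ws @ vs)"
    using b(2) set_eq by (intro contiguous_const[where c = "g s"]) auto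
  ultimately have "contiguous f ((ws @ vs) @ zs)" "contiguous g ((ws @ vs) @ zs)"
    using c fdis(2) gdis(2) set_eq by (simp_all only: contiguous_append)
  moreover have "set ((ws @ vs) @ zs) = set (ms @ zs)" using vw(1) by auto
  ultimately have "contiguous f (us @ (ws @ vs) @ zs)" "contiguous g (us @ (ws @ vs) @ zs)"
    using c fdis(1) gdis(1) by (simp_all only: contiguous_append)
  then show thesis
    using b(1) vw by (intro that[of us vs ws zs]) simp_all
qed

section \<open>Existence of a list contiguous for both maps\<close>

text \<open>Append the lists given by \<open>block\<close>, one for each value of \<open>g\<close>.
  By \<open>fg\<close>, lists for different values share no \<open>f\<close>-value either.\<close>

lemma exists_contiguous_list:
  assumes "finite E"
    and fg: "\<And>x y. x \<in> E \<Longrightarrow> y \<in> E \<Longrightarrow> f x = f y \<Longrightarrow> g x = g y"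
    and block: "\<And>b. \<exists>xs. set xs = {x \<in> E. g x = b} \<and> distinct xs \<and> contiguous f xs"
  shows "\<exists>xs. set xs = E \<and> distinct xs \<and> contiguous f xs \<and> contiguous g xs"
proof -
  have "\<exists>xs. set xs = {x \<in> E. g x \<in> V} \<and> distinct xs \<and> contiguous f xs \<and> contiguous g xs"
    if "finite V" for V
    using that
  proof (induction V rule: finite_induct)
    case empty
    show ?case by (simp add: contiguous_def)
  next
    case (insert b V)
    then obtain xs where xs: "set xs = {x \<in> E. g x \<in> V}" "distinct xs" "contiguous f xs" "contiguous g xs"
      by blast
    obtain ys where ys: "set ys = {x \<in> E. g x = b}" "distinct ys" "contiguous f ys"
      using block by blast
    have "contiguous g ys" using ys(1) by (intro contiguous_const) auto
    moreover have "g ` set xs \<inter> g ` set ys = {}" using xs(1) ys(1) insert.hyps by auto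
    moreover have "f x \<noteq> f y" if "x \<in> set xs" "y \<in> set ys" for x y
      using fg[of x y] that xs(1) ys(1) insert.hyps by auto
    then have "f ` set xs \<inter> f ` set ys = {}" by auto
    ultimately show ?case
      using xs ys insert.hyps by (intro exI[of _ "xs @ ys"]) (auto simp: contiguous_append)
  qed
  moreover have "{x \<in> E. g x \<in> g ` E} = E" by blast
  ultimately show ?thesis using assms(1) by (metis finite_imageI)
qed

lemma exists_contiguous_list_refining:
  assumes "finite E"
    and fg: "\<And>x y. x \<in> E \<Longrightarrow> y \<in> E \<Longrightarrow> f x = f y \<Longrightarrow> g x = g y"
  shows "\<exists>xs. set xs = E \<and> distinct xs \<and> contiguous f xs \<and> contiguous g xs"
proof (rule exists_contiguous_list[OF assms])
  \<comment> \<open>The construction is used twice: with \<open>f\<close> in both roles, where the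
    blocks have constant \<open>f\<close>, to arrange each fibre of \<open>g\<close>, and then for
    \<open>f\<close> and \<open>g\<close> to join these fibres.\<close>
  have f: "\<exists>xs. set xs = F \<and> distinct xs \<and> contiguous f xs" if "finite F" for F
  proof -
    have "\<exists>xs. set xs = {x \<in> F. f x = a} \<and> distinct xs \<and> contiguous f xs" for a
    proof -
      obtain xs where "set xs = {x \<in> F. f x = a}" "distinct xs"
        using finite_distinct_list[of "{x \<in> F. f x = a}"] \<open>finite F\<close> by auto
      then show ?thesis using contiguous_const[of xs f a] by auto
    qed
    then show ?thesis using exists_contiguous_list[of F f f] that by blast
  qed
  show "\<exists>xs. set xs = {x \<in> E. g x = b} \<and> distinct xs \<and> contiguous f xs" for b
    using f[of "{x \<in> E. g x = b}"] assms(1) by simp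
qed

section \<open>Passing between distinct lists and strong total orders\<close>

lemma strong_total_order_precedes:
  assumes "distinct xs"
  shows "strong_total_order (set xs) {(x, y). precedes xs x y}"
proof -
  have "precedes xs x z" if "precedes xs x y" "precedes xs y z" for x y z
    using that assms unfolding precedes_iff_nth by (metis nth_eq_iff_index_eq order_less_trans)
  moreover have "\<not> precedes xs x x" for x
    using precedes_asym[OF assms] by blast
  moreover have "x \<in> set xs" "y \<in> set xs" if "precedes xs x y" for x y
    using that unfolding precedes_def by auto
  ultimately show ?thesis
    using precedes_total[of _ xs]
    by (auto simp: strong_total_order_def strict_linear_order_on_def total_on_def
        intro!: transI irreflI)
qed

text \<open>\<open>xs\<close> meets the description that determines \<open>order_list\<close>
  uniquely. Thus a rearranged list can be turned into an order whose listing is known.\<close>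

lemma order_list_precedes:
  assumes "distinct xs"
  shows "order_list (set xs) {(x, y). precedes xs x y} = xs"
proof -
  let ?T = "{(x, y). precedes xs x y}"
  have "sorted_wrt (\<lambda>x y. (x, y) \<in> ?T) xs"
    by (auto simp: sorted_wrt_iff_nth_less precedes_iff_nth)
  then show ?thesis
    using order_list_ex1[OF finite_set strong_total_order_precedes[OF assms]]
      order_list[OF finite_set strong_total_order_precedes[OF assms]] by blast
qed

lemma distinct_order_list:
  assumes "finite E" and "strong_total_order E T"
  shows "distinct (order_list E T)"
  using order_list(2)[OF assms] assms(2)
  by (auto simp: distinct_conv_nth sorted_wrt_iff_nth_less strong_total_order_def
      strict_linear_order_on_def irrefl_def nat_neq_iff) metis+

lemma projects_iff: "projects val E T C \<longleftrightarrow> contiguous (\<lambda>t. val t C) (order_list E T)"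
  by (simp add: projects_def collapsed_values_def contiguous_def)

lemma derived_order_iff:
  "(a, b) \<in> derived_order val E T C \<longleftrightarrow> precedes (remdups_adj (map (\<lambda>t. val t C) (order_list E T))) a b"
  by (auto simp: derived_order_def collapsed_values_def precedes_iff_nth Let_def)

lemma witness_precedes:
  assumes "distinct xs" "contiguous (\<lambda>t. val t A) xs" "contiguous (\<lambda>t. val t B) xs"
  shows "witness val (set xs) A B {(x, y). precedes xs x y}"
  using assms by (simp add: witness_def projects_iff order_list_precedes strong_total_order_precedes)

section \<open>Collapse of the strongest derivable orders\<close>

text \<open>Two members of the witness class suffice to exclude a given pair: \<open>T\<close>
  itself and the result of one transposition.\<close>

lemma strongest_derivable_order_empty:
  assumes "finite E"
    and fd: "\<And>s t. s \<in> E \<Longrightarrow> t \<in> E \<Longrightarrow> val s A = val t A \<Longrightarrow> val s B = val t B"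
    and w: "witness val E A B T"
    and C: "C = A \<or> C = B"
  shows "strongest_derivable_order val E A B T C = {}"
proof -
  have False if ab: "(a, b) \<in> strongest_derivable_order val E A B T C" for a b
  proof -
    define xs where "xs = order_list E T"
    have sto: "strong_total_order E T" using w by (simp add: witness_def)
    have E: "set xs = E" and d: "distinct xs"
      using order_list(1)[OF assms(1) sto] distinct_order_list[OF assms(1) sto] by (simp_all add: xs_def)
    have cA: "contiguous (\<lambda>t. val t A) xs" and cB: "contiguous (\<lambda>t. val t B) xs"
      using w by (simp_all add: witness_def projects_iff xs_def)
    have in_derived: "(a, b) \<in> derived_order val E T' C" if "T' \<in> witness_class val E A B T" for T'
      using ab that by (simp add: strongest_derivable_order_def)
    \<comment> \<open>\<open>T\<close> lies in its own class by reflexivity of the closure.\<close>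
    have "precedes (remdups_adj (map (\<lambda>t. val t C) xs)) a b"
      using in_derived[of T] by (simp add: witness_class_def derived_order_iff xs_def)
    then obtain ps qs where pq: "remdups_adj (map (\<lambda>t. val t C) xs) = ps @ qs" "a \<in> set ps" "b \<in> set qs"
      unfolding precedes_def by blast
    have "distinct (ps @ qs)" using cA cB C pq(1) by (auto simp: contiguous_def)
    then have neq: "a \<noteq> b" using pq by auto
    \<comment> \<open>The cut between the values \<open>a\<close> and \<open>b\<close> is pulled
      back to obtain tuples \<open>s\<close> before \<open>t\<close> carrying them.\<close>
    obtain us vs where uv: "xs = us @ vs" "remdups_adj (map (\<lambda>t. val t C) us) = ps"
      "remdups_adj (map (\<lambda>t. val t C) vs) = qs"
      using pq(1) by (rule remdups_adj_map_eq_append)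
    then obtain s t where st: "s \<in> set us" "t \<in> set vs" "val s C = a" "val t C = b"
      using pq uv(2,3)[THEN image_eq_set_remdups_adj_map] by (metis (no_types, lifting) imageE)
    have pst: "precedes xs s t" using st uv(1) unfolding precedes_def by blast
    have "s \<in> E" "t \<in> E" using st uv(1) E by auto
    \<comment> \<open>For \<open>C = B\<close> this is the contrapositive of
      \<open>fd\<close>.\<close>
    then have nA: "val s A \<noteq> val t A" using neq st C fd by metis
    obtain us vs ws zs where dec: "xs = us @ vs @ ws @ zs" "s \<in> set vs" "t \<in> set ws"
      and c': "contiguous (\<lambda>t. val t A) (us @ ws @ vs @ zs)" "contiguous (\<lambda>t. val t B) (us @ ws @ vs @ zs)"
      using exchange_reversing_pair[OF d cA cB _ pst nA] fd E by metis
    define ys where "ys = us @ ws @ vs @ zs"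
    define T' where "T' = {(x, y). precedes ys x y}"
    have dy: "distinct ys" and Ey: "set ys = E" using d E dec(1) by (auto simp: ys_def)
    have ol: "order_list E T' = ys" using order_list_precedes[OF dy] by (simp add: T'_def Ey)
    have "witness val E A B T'" using witness_precedes[OF dy, of val A B] c' unfolding T'_def Ey[symmetric] ys_def by blast
    moreover have "vs \<noteq> []" "ws \<noteq> []" using dec by auto
    ultimately have "valid_transposition val E A B T T'"
      unfolding valid_transposition_def ol using w dec(1) unfolding xs_def ys_def by blast
    then have "T' \<in> witness_class val E A B T" by (auto simp: witness_class_def)
    then have "precedes (remdups_adj (map (\<lambda>t. val t C) ys)) a b"
      using in_derived[of T'] by (simp add: derived_order_iff ol)
    \<comment> \<open>The exchange put \<open>t\<close> before \<open>s\<close>, so \<open>b\<close>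
      also precedes \<open>a\<close> among the collapsed values, which are distinct because the new
      order is a witness.\<close>
    moreover have "precedes (us @ (ws @ vs) @ zs) t s"
      using dec by (intro precedes_append) (auto simp: precedes_def)
    then have "precedes (map (\<lambda>t. val t C) ys) b a"
      using precedes_map[of ys t s "\<lambda>t. val t C"] st by (simp add: ys_def)
    then have "precedes (remdups_adj (map (\<lambda>t. val t C) ys)) b a"
      using neq by (intro precedes_remdups_adj) auto
    moreover have "distinct (remdups_adj (map (\<lambda>t. val t C) ys))"
      using c' C by (auto simp: contiguous_def ys_def)
    ultimately show False using precedes_asym by metis
  qed
  then show ?thesis by auto
qed

theorem theorem6:
  fixes val :: "'t \<Rightarrow> 'attr \<Rightarrow> 'v"
    and r :: "'t set"
    and X :: "'attr set"
    and A B :: 'attr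
  assumes "finite r"
    and "functional_dependency val r (X \<union> {A}) B"
  shows "valid_candidate val r X A B \<and>
    (\<forall>G\<in>partition_groups val r X. \<forall>T. witness val G A B T \<longrightarrow>
       strongest_derivable_order val G A B T A = {} \<and>
       strongest_derivable_order val G A B T B = {})"
proof -
  have fin: "finite G" if "G \<in> partition_groups val r X" for G
    using that assms(1) by (auto simp: partition_groups_def agreeing_subset_def intro: finite_subset)
  have fd: "val s B = val t B"
    if "G \<in> partition_groups val r X" "s \<in> G" "t \<in> G" "val s A = val t A" for G s t
  proof -
    \<comment> \<open>Membership in one group supplies agreement on \<open>X\<close>, and the equal
      \<open>A\<close>-values supply the rest.\<close>
    have "agree val (X \<union> {A}) s t" "s \<in> r" "t \<in> r"
      using that unfolding partition_groups_def agreeing_subset_def agree_def by blast+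
    then show ?thesis using assms(2) unfolding functional_dependency_def by blast
  qed
  have "\<exists>T. witness val G A B T" if G: "G \<in> partition_groups val r X" for G
  proof -
    obtain xs where "set xs = G" "distinct xs"
      "contiguous (\<lambda>t. val t A) xs" "contiguous (\<lambda>t. val t B) xs"
      using exists_contiguous_list_refining[OF fin[OF G], of "\<lambda>t. val t A" "\<lambda>t. val t B"] fd[OF G]
      by blast
    then show ?thesis using witness_precedes by metis
  qed
  then show ?thesis
    unfolding valid_candidate_def
    using strongest_derivable_order_empty[of _ val A B, OF fin fd] by simp
qed

end
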